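(* Let $X=(X_1,X_2)$ be a random variable with values in $\mathbb{R}^2$ such that (i) $X$ is not constrained to a hyperplane (there is no line in $\mathbb{R}^2$ containing $X$ almost surely), and (ii) $\mathbb{P}[X\in(0,\infty)^2]>0$. Let $X(n)$, $n\ge1$, be i.i.d. copies of $X$ and $S(n)=X(1)+\dots+X(n)$. Let $W^0(n)$ be the Lindley process started at the origin: $W^0(0)=0$ and $W^0(n)=\max\{0,W^0(n-1)-X(n)\}$ for $n\ge1$, with the maximum taken coordinate-wise. For $x\in(0,\infty)^2$ let $\tau_x=\inf\{n\ge1:x+S(n)\notin(0,\infty)^2\}$. Then for every $x=(x_1,x_2)\in(0,\infty)^2$ and every $n$, $$\mathbb{P}\bigl[W^0(n)\in[0,x_1)\times[0,x_2)\bigr]=\mathbb{P}[\tau_x>n].$$ *)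

theory Defs
  imports "HOL-Probability.Probability" "HOL-Library.Extended_Nat"
begin

text \<open>
  All processes are defined pathwise, for a deterministic sequence of increments
  \<open>x 1, x 2, \<dots>\<close>; the value \<open>x 0\<close> is never used.
\<close>

definition pos_quadrant :: "(real ^ 2) set" where
  "pos_quadrant = {v. \<forall>i. 0 < v $ i}"

definition walk :: "(nat \<Rightarrow> real ^ 2) \<Rightarrow> nat \<Rightarrow> real ^ 2" where
  "walk x n = (\<Sum>k = 1..n. x k)"

primrec lindley :: "real ^ 2 \<Rightarrow> (nat \<Rightarrow> real ^ 2) \<Rightarrow> nat \<Rightarrow> real ^ 2" where
  "lindley w x 0 = w"
| "lindley w x (Suc n) = (\<chi> i. max 0 (lindley w x n $ i - x (Suc n) $ i))"

text \<open>
  The infimum is taken in \<^typ>\<open>enat\<close>, so that the exit time is \<open>\<infinity>\<close> if the walk started at \<open>y\<close>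
  never leaves the open quadrant.
\<close>

definition exit_time :: "real ^ 2 \<Rightarrow> (nat \<Rightarrow> real ^ 2) \<Rightarrow> enat" where
  "exit_time y x = (INF n \<in> {n. 1 \<le> n \<and> y + walk x n \<notin> pos_quadrant}. enat n)"

end

theory Submission
  imports Defs
begin

text \<open>
  Unrolling the Lindley recursion turns the coordinates of the process into maxima of partial
  sums taken backwards in time: \<open>W\<^sup>0(n) = max {- (X(m+1) + \<dots> + X(n)) | m \<le> n}\<close>.  Hence
  \<open>W\<^sup>0(n) < x\<close> says that \<open>x\<close> plus each of the sums \<open>X(n) + X(n-1) + \<dots> + X(m+1)\<close> lies in the open
  quadrant, that is, that the walk with the increments \<open>X(n), \<dots>, X(1)\<close> in reversed order, started
  at \<open>x\<close>, has not left the quadrant by time \<open>n\<close>.  This is an identity between individual paths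
  (lemma \<open>lindley_below_iff_reversed_exit_time\<close>); the random input is only that the reversed tuple
  of independent, identically distributed increments has the same law as the original one (lemma
  \<open>distr_iid_reindex\<close>).
\<close>

lemma lindley_nonneg: "0 \<le> lindley 0 y n $ i"
  by (cases n) auto

text \<open>
  One step of the recursion moves the barrier rather than the process: the new value is below \<open>b\<close> iff
  \<open>b\<close> is positive and the old value is below \<open>b + y (Suc n) $ i\<close>.  This is why the barrier has to be
  generalised in the induction.
\<close>

lemma lindley_less_iff_tail_sums:
  "lindley 0 y n $ i < b \<longleftrightarrow> (\<forall>m\<le>n. 0 < b + (\<Sum>k = Suc m..n. y k $ i))"
proof (induction n arbitrary: b)
  case 0
  then show ?case by simp
next
  case (Suc n)
  have "lindley 0 y (Suc n) $ i < b \<longleftrightarrow> 0 < b \<and> lindley 0 y n $ i < b + y (Suc n) $ i"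
    by auto
  also have "\<dots> \<longleftrightarrow> 0 < b \<and> (\<forall>m\<le>n. 0 < b + (\<Sum>k = Suc m..Suc n. y k $ i))"
    by (simp add: Suc.IH add_ac)
  also have "\<dots> \<longleftrightarrow> (\<forall>m\<le>Suc n. 0 < b + (\<Sum>k = Suc m..Suc n. y k $ i))"
    by (auto simp: le_Suc_eq)
  finally show ?case .
qed

lemma walk_reversed:
  assumes "m \<le> n"
  shows "walk (\<lambda>k. y (Suc n - k)) (n - m) = (\<Sum>k = Suc m..n. y k)"
  unfolding walk_def
  by (rule sum.reindex_bij_witness[of _ "\<lambda>k. Suc n - k" "\<lambda>k. Suc n - k"]) (use assms in auto)

lemma exit_time_greater_iff:
  "enat n < exit_time x y \<longleftrightarrow> (\<forall>m\<in>{1..n}. x + walk y m \<in> pos_quadrant)"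
proof -
  have "enat n < exit_time x y \<longleftrightarrow> enat (Suc n) \<le> exit_time x y"
    by (simp add: Suc_ile_eq)
  also have "\<dots> \<longleftrightarrow> (\<forall>m. 1 \<le> m \<and> x + walk y m \<notin> pos_quadrant \<longrightarrow> Suc n \<le> m)"
    by (simp add: exit_time_def le_INF_iff)
  also have "\<dots> \<longleftrightarrow> (\<forall>m\<in>{1..n}. x + walk y m \<in> pos_quadrant)"
    by (auto simp: not_less_eq_eq[symmetric])
  finally show ?thesis .
qed

lemma lindley_below_iff_reversed_exit_time:
  assumes "x \<in> pos_quadrant"
  shows "lindley 0 y n \<in> {w. \<forall>i. 0 \<le> w $ i \<and> w $ i < x $ i}
           \<longleftrightarrow> enat n < exit_time x (\<lambda>k. y (Suc n - k))"
proof -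
  let ?r = "\<lambda>k. y (Suc n - k)"
  have "lindley 0 y n \<in> {w. \<forall>i. 0 \<le> w $ i \<and> w $ i < x $ i}
          \<longleftrightarrow> (\<forall>m\<le>n. x + (\<Sum>k = Suc m..n. y k) \<in> pos_quadrant)"
    by (auto simp: lindley_nonneg lindley_less_iff_tail_sums pos_quadrant_def)
  also have "\<dots> \<longleftrightarrow> (\<forall>m\<le>n. x + walk ?r (n - m) \<in> pos_quadrant)"
    by (simp add: walk_reversed)
  also have "\<dots> \<longleftrightarrow> (\<forall>m\<le>n. x + walk ?r m \<in> pos_quadrant)"
    by (metis diff_diff_cancel diff_le_self)
  \<comment> \<open>The exit time counts from time 1 on; the condition at time 0 is that the starting point lies in
    the quadrant.\<close>
  also have "\<dots> \<longleftrightarrow> (\<forall>m\<in>{1..n}. x + walk ?r m \<in> pos_quadrant)"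
  proof -
    have "x + walk ?r 0 \<in> pos_quadrant"
      using assms by (simp add: walk_def)
    moreover have "{..n} = insert 0 {1..n}"
      by auto
    ultimately show ?thesis
      by (metis atMost_iff insert_iff)
  qed
  finally show ?thesis
    by (simp only: exit_time_greater_iff)
qed

text \<open>
  Both joint laws are the product of the common marginal law, because an injective relabelling of the
  coordinates carries this product measure to itself.
\<close>

lemma (in prob_space) distr_iid_reindex:
  assumes indep: "indep_vars (\<lambda>_. N) Y I"
    and ident: "\<And>i. i \<in> I \<Longrightarrow> distr M N (Y i) = D"
    and p: "inj_on p I" "p \<in> I \<rightarrow> I"
  shows "distr M (\<Pi>\<^sub>M i\<in>I. N) (\<lambda>\<omega>. \<lambda>i\<in>I. Y (p i) \<omega>) = distr M (\<Pi>\<^sub>M i\<in>I. N) (\<lambda>\<omega>. \<lambda>i\<in>I. Y i \<omega>)"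
proof (cases "I = {}")
  case True
  then show ?thesis by (simp add: restrict_def)
next
  case False
  let ?Y = "\<lambda>\<omega>. \<lambda>i\<in>I. Y i \<omega>" and ?p = "\<lambda>f. \<lambda>i\<in>I. f (p i)"
  have rv: "random_variable N (Y i)" if "i \<in> I" for i
    using indep that by (auto simp: indep_vars_def2)
  obtain i where "i \<in> I" using False by blast
  then have D: "prob_space D" "sets D = sets N"
    using prob_space_distr[OF rv] ident by (metis, metis sets_distr)
  have sets_PiM: "sets (\<Pi>\<^sub>M i\<in>I. D) = sets (\<Pi>\<^sub>M i\<in>I. N)"
    using D(2) by (intro sets_PiM_cong) auto
  have "distr M (\<Pi>\<^sub>M i\<in>I. N) ?Y = (\<Pi>\<^sub>M i\<in>I. distr M N (Y i))"
    using indep indep_vars_iff_distr_eq_PiM'[OF False rv, of "\<lambda>i. i"] by simp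
  also have "\<dots> = (\<Pi>\<^sub>M i\<in>I. D)"
    using ident by (intro PiM_cong) auto
  finally have law: "distr M (\<Pi>\<^sub>M i\<in>I. N) ?Y = (\<Pi>\<^sub>M i\<in>I. D)" .
  have "(\<lambda>\<omega>. \<lambda>i\<in>I. Y (p i) \<omega>) = ?p \<circ> ?Y"
    using p(2) by (auto simp: fun_eq_iff restrict_def)
  moreover have "?p \<in> measurable (\<Pi>\<^sub>M i\<in>I. N) (\<Pi>\<^sub>M i\<in>I. N)"
    using p(2) by (intro measurable_restrict measurable_component_singleton) auto
  moreover have "?Y \<in> measurable M (\<Pi>\<^sub>M i\<in>I. N)"
    using rv by (rule measurable_restrict)
  ultimately have "distr M (\<Pi>\<^sub>M i\<in>I. N) (\<lambda>\<omega>. \<lambda>i\<in>I. Y (p i) \<omega>)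
      = distr (distr M (\<Pi>\<^sub>M i\<in>I. N) ?Y) (\<Pi>\<^sub>M i\<in>I. N) ?p"
    by (simp add: distr_distr)
  also have "\<dots> = distr (\<Pi>\<^sub>M i\<in>I. D) (\<Pi>\<^sub>M i\<in>I. D) ?p"
    using sets_PiM by (simp add: law cong: distr_cong)
  also have "\<dots> = (\<Pi>\<^sub>M i\<in>I. D)"
    using D(1) p by (intro distr_PiM_reindex)
  finally show ?thesis
    by (simp only: law)
qed

lemma pos_quadrant_in_borel: "pos_quadrant \<in> sets borel"
proof -
  have "open (\<Inter>i. {v :: real ^ 2. 0 < v $ i})"
    by (intro open_INT ballI open_Collect_less continuous_intros) auto
  moreover have "pos_quadrant = (\<Inter>i. {v. 0 < v $ i})"
    by (auto simp: pos_quadrant_def)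
  ultimately show ?thesis
    by simp
qed

text \<open>
  Survival up to time \<open>n\<close> depends on the first \<open>n\<close> increments only, so it is an event for their joint
  law on a finite product space.
\<close>

lemma exit_time_greater_restrict:
  "enat n < exit_time x (\<lambda>k\<in>{1..n}. y k) \<longleftrightarrow> enat n < exit_time x y"
  by (simp add: exit_time_greater_iff walk_def)

lemma exit_time_greater_measurable:
  "{f \<in> space (\<Pi>\<^sub>M k\<in>{1..n}. borel). enat n < exit_time x f} \<in> sets (\<Pi>\<^sub>M k\<in>{1..n}. borel)"
proof -
  have meas: "(\<lambda>f. x + walk f m) \<in> borel_measurable (\<Pi>\<^sub>M k\<in>{1..n}. borel)" if "m \<in> {1..n}" for m
    unfolding walk_def
    using that by (intro borel_measurable_add borel_measurable_const borel_measurable_sum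
      measurable_component_singleton) auto
  then show ?thesis
    unfolding exit_time_greater_iff
    by (intro sets.sets_Collect_finite_All' predE pred_sets2[OF pos_quadrant_in_borel meas]
        sets.sets_Collect_finite_All) auto
qed

theorem lemma1p5:
  fixes M :: "'a measure"
    and X :: "'a \<Rightarrow> real ^ 2"
    and Xs :: "nat \<Rightarrow> 'a \<Rightarrow> real ^ 2"
    and x :: "real ^ 2"
    and n :: nat
  assumes "prob_space M"
    and "X \<in> borel_measurable M"
    and "\<not> (\<exists>a c. a \<noteq> 0 \<and> (AE \<omega> in M. X \<omega> \<in> {v. a \<bullet> v = c}))"
    and "\<P>(\<omega> in M. X \<omega> \<in> pos_quadrant) > 0"
    and "prob_space.indep_vars M (\<lambda>_. borel) Xs {1..}"
    and "\<And>k. 1 \<le> k \<Longrightarrow> distr M borel (Xs k) = distr M borel X"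
    and "x \<in> pos_quadrant"
  shows "\<P>(\<omega> in M. lindley 0 (\<lambda>k. Xs k \<omega>) n \<in> {w. \<forall>i. 0 \<le> w $ i \<and> w $ i < x $ i})
       = \<P>(\<omega> in M. exit_time x (\<lambda>k. Xs k \<omega>) > enat n)"
proof -
  interpret prob_space M by fact
  let ?P = "\<Pi>\<^sub>M k\<in>{1..n}. borel :: (real ^ 2) measure"
  let ?A = "{f \<in> space ?P. enat n < exit_time x f}"
  have indep: "indep_vars (\<lambda>_. borel) Xs {1..n}"
    by (rule indep_vars_subset[OF assms(5)]) auto
  have rv: "Xs k \<in> borel_measurable M" if "k \<in> {1..n}" for k
    using indep that by (auto simp: indep_vars_def)
  have reversal: "inj_on (\<lambda>k. Suc n - k) {1..n}" "(\<lambda>k. Suc n - k) \<in> {1..n} \<rightarrow> {1..n}"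
    by (auto simp: inj_on_def)
  have survival: "\<P>(\<omega> in M. enat n < exit_time x (\<lambda>k. Z k \<omega>))
      = measure (distr M ?P (\<lambda>\<omega>. \<lambda>k\<in>{1..n}. Z k \<omega>)) ?A"
    if Z: "\<And>k. k \<in> {1..n} \<Longrightarrow> Z k \<in> borel_measurable M" for Z
  proof -
    have "(\<lambda>\<omega>. \<lambda>k\<in>{1..n}. Z k \<omega>) \<in> measurable M ?P"
      using Z by (rule measurable_restrict)
    then have "measure (distr M ?P (\<lambda>\<omega>. \<lambda>k\<in>{1..n}. Z k \<omega>)) ?A
        = measure M ((\<lambda>\<omega>. \<lambda>k\<in>{1..n}. Z k \<omega>) -` ?A \<inter> space M)"
      by (rule measure_distr[OF _ exit_time_greater_measurable])
    also have "(\<lambda>\<omega>. \<lambda>k\<in>{1..n}. Z k \<omega>) -` ?A \<inter> space M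
        = {\<omega> \<in> space M. enat n < exit_time x (\<lambda>k. Z k \<omega>)}"
      by (auto simp: exit_time_greater_restrict space_PiM simp del: One_nat_def)
    finally show ?thesis ..
  qed
  have "\<P>(\<omega> in M. lindley 0 (\<lambda>k. Xs k \<omega>) n \<in> {w. \<forall>i. 0 \<le> w $ i \<and> w $ i < x $ i})
      = \<P>(\<omega> in M. enat n < exit_time x (\<lambda>k. Xs (Suc n - k) \<omega>))"
    by (simp only: lindley_below_iff_reversed_exit_time[OF assms(7)])
  also have "\<dots> = measure (distr M ?P (\<lambda>\<omega>. \<lambda>k\<in>{1..n}. Xs (Suc n - k) \<omega>)) ?A"
    by (rule survival) (rule rv, auto)
  also have "\<dots> = measure (distr M ?P (\<lambda>\<omega>. \<lambda>k\<in>{1..n}. Xs k \<omega>)) ?A"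
    using distr_iid_reindex[OF indep _ reversal] assms(6) by simp
  also have "\<dots> = \<P>(\<omega> in M. enat n < exit_time x (\<lambda>k. Xs k \<omega>))"
    using rv by (rule survival[symmetric])
  finally show ?thesis .
qed

end
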